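(* Every finite-dimensional vector subspace of an Archimedean vector lattice $X$ is order closed in $X$.
   Context: Vector lattices are real. A net $(x_\alpha)$ in a vector lattice $X$ converges in order to $x$ if there is a net $(y_\beta)$ (possibly with a different index set) with $y_\beta\searrow 0$ such that for every $\beta$ there is $\alpha_0$ with $|x_\alpha-x|\le y_\beta$ for all $\alpha\ge\alpha_0$. A set $A\subseteq X$ is order closed in $X$ if it consists precisely of those $x\in X$ for which there exists a net in $A$ that converges in order to $x$ in $X$. *)

theory Defs
  imports Complex_Main "HOL-Library.Lattice_Algebras"
begin

class vector_lattice = ordered_real_vector + lattice_ab_group_add_abs

text \<open>Archimedean: $\frac{1}{n} x \searrow 0$, i.e. $\inf_n \frac{1}{n} x = 0$, for every
  $x \geq 0$.  That $0$ is a lower bound and that the sequence decreases holds in every vector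
  lattice; only the ``greatest lower bound'' part is an axiom.\<close>

class archimedean_vector_lattice = vector_lattice +
  assumes archimedean: "0 \<le> x \<Longrightarrow> (\<And>n::nat. n \<ge> 1 \<Longrightarrow> z \<le> (1 / real n) *\<^sub>R x) \<Longrightarrow> z \<le> 0"

text \<open>A net is a function restricted to a directed index set, given by a carrier \<open>I\<close> and a
  preorder \<open>r\<close> on it, where \<open>(i, j) \<in> r\<close> means that \<open>j\<close> is later than \<open>i\<close>.\<close>

definition directed_set :: "'i set \<Rightarrow> 'i rel \<Rightarrow> bool" where
  "directed_set I r \<longleftrightarrow>
     I \<noteq> {} \<and> preorder_on I r \<and> (\<forall>i\<in>I. \<forall>j\<in>I. \<exists>k\<in>I. (i, k) \<in> r \<and> (j, k) \<in> r)"

definition decreases_to_zero :: "'j set \<Rightarrow> 'j rel \<Rightarrow> ('j \<Rightarrow> 'a::vector_lattice) \<Rightarrow> bool" where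
  "decreases_to_zero J s y \<longleftrightarrow>
     (\<forall>(\<beta>, \<gamma>)\<in>s. y \<gamma> \<le> y \<beta>) \<and>
     (\<forall>\<beta>\<in>J. 0 \<le> y \<beta>) \<and> (\<forall>z. (\<forall>\<beta>\<in>J. z \<le> y \<beta>) \<longrightarrow> z \<le> 0)"

text \<open>``There exists a net'' ranges over all directed index sets.  Types cannot be quantified
  inside a formula, so the types that the index sets are drawn from are made explicit parameters:
  \<open>'i\<close> for the nets in the set, \<open>'j\<close> for the dominating nets.  Leaving both types free in a
  theorem with conclusion \<open>order_closed TYPE('i) TYPE('j) A\<close> asserts it for all index sets of all
  types. Since one-point index sets exist in every type, constant nets show that \<open>A\<close> is always
  included in the set of limits, so this is exactly order closedness with
  unrestricted index sets.\<close>

definition order_converges ::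
    "'j itself \<Rightarrow> 'i set \<Rightarrow> 'i rel \<Rightarrow> ('i \<Rightarrow> 'a::vector_lattice) \<Rightarrow> 'a \<Rightarrow> bool" where
  "order_converges _ I r x l \<longleftrightarrow>
     (\<exists>(J :: 'j set) s y. directed_set J s \<and> decreases_to_zero J s y \<and>
        (\<forall>\<beta>\<in>J. \<exists>\<alpha>0\<in>I. \<forall>\<alpha>\<in>I. (\<alpha>0, \<alpha>) \<in> r \<longrightarrow> \<bar>x \<alpha> - l\<bar> \<le> y \<beta>))"

definition order_closed :: "'i itself \<Rightarrow> 'j itself \<Rightarrow> 'a::vector_lattice set \<Rightarrow> bool" where
  "order_closed _ _ A \<longleftrightarrow>
     A = {l. \<exists>(I :: 'i set) r x. directed_set I r \<and> (\<forall>\<alpha>\<in>I. x \<alpha> \<in> A) \<and>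
               order_converges TYPE('j) I r x l}"

definition finite_dimensional_subspace :: "'a::real_vector set \<Rightarrow> bool" where
  "finite_dimensional_subspace Y \<longleftrightarrow>
     subspace Y \<and> (\<exists>B. finite B \<and> independent B \<and> span B = Y)"

end

theory Submission
  imports Defs "HOL-Analysis.Elementary_Metric_Spaces"
begin

text \<open>Induction on the dimension. Let \<open>l\<close> be adherent to \<open>Y' + \<real> b\<close> with \<open>b \<notin> Y'\<close>, and for a
  dominating element \<open>d\<close> consider the set of those real \<open>t\<close> for which \<open>l - t b\<close> is within \<open>d\<close> of
  \<open>Y'\<close>. If such a set were unbounded, dividing by \<open>t\<close> would show that \<open>b\<close> is adherent to \<open>Y'\<close>, hence
  in \<open>Y'\<close>. So the closures of these sets are, from some \<open>d\<close> on, a directed family of nonempty compact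
  sets of reals, and have a common point \<open>t\<close>. Then \<open>l - t b\<close> is adherent to \<open>Y'\<close>, hence in \<open>Y'\<close>.\<close>

text \<open>The range of a dominating net with its index set forgotten. The induction below switches
  to new dominating families, indexed by naturals or by pairs; working with sets of values keeps one
  type throughout.\<close>

definition directed_to_zero :: "'a::vector_lattice set \<Rightarrow> bool" where
  "directed_to_zero D \<longleftrightarrow>
     D \<noteq> {} \<and> (\<forall>a\<in>D. \<forall>b\<in>D. \<exists>c\<in>D. c \<le> a \<and> c \<le> b) \<and> (\<forall>z. (\<forall>d\<in>D. z \<le> d) \<longrightarrow> z \<le> 0)"

lemma abs_scaleR_le: "\<bar>t *\<^sub>R x\<bar> \<le> \<bar>t\<bar> *\<^sub>R \<bar>x :: 'a::vector_lattice\<bar>"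
proof (rule abs_leI)
  have *: "s *\<^sub>R x \<le> \<bar>s\<bar> *\<^sub>R \<bar>x\<bar>" for s :: real
  proof (cases "s \<ge> 0")
    case True
    then show ?thesis by (simp add: scaleR_left_mono[OF abs_ge_self])
  next
    case False
    have "(- s) *\<^sub>R (- x) \<le> (- s) *\<^sub>R \<bar>x\<bar>"
      using False by (intro scaleR_left_mono abs_ge_minus_self) simp
    then show ?thesis using False by simp
  qed
  show "t *\<^sub>R x \<le> \<bar>t\<bar> *\<^sub>R \<bar>x\<bar>" by (rule *)
  show "- (t *\<^sub>R x) \<le> \<bar>t\<bar> *\<^sub>R \<bar>x\<bar>" using *[of "- t"] by simp
qed

text \<open>The Archimedean axiom in the form used when an unbounded range of coefficients is
  divided out.\<close>

lemma directed_to_zero_multiples: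
  fixes u :: "'a::archimedean_vector_lattice"
  assumes "0 \<le> u"
  shows "directed_to_zero {(1 / real n) *\<^sub>R u | n. n \<ge> 1}"
  unfolding directed_to_zero_def
proof (intro conjI ballI allI impI)
  show "{(1 / real n) *\<^sub>R u | n. n \<ge> 1} \<noteq> {}" by auto
next
  fix a b assume "a \<in> {(1 / real n) *\<^sub>R u | n. n \<ge> 1}" "b \<in> {(1 / real n) *\<^sub>R u | n. n \<ge> 1}"
  then obtain m n where mn: "m \<ge> 1" "n \<ge> 1" "a = (1 / real m) *\<^sub>R u" "b = (1 / real n) *\<^sub>R u"
    by blast
  have "(1 / real (max m n)) *\<^sub>R u \<le> a" "(1 / real (max m n)) *\<^sub>R u \<le> b"
    using mn assms by (auto intro!: scaleR_right_mono simp: field_simps)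
  moreover have "max m n \<ge> 1" using mn by simp
  ultimately show "\<exists>c\<in>{(1 / real n) *\<^sub>R u | n. n \<ge> 1}. c \<le> a \<and> c \<le> b" by blast
next
  fix z assume "\<forall>d\<in>{(1 / real n) *\<^sub>R u | n. n \<ge> 1}. z \<le> d"
  then show "z \<le> 0" by (intro archimedean[OF assms]) blast
qed

text \<open>For a lower bound \<open>z\<close> and fixed \<open>n\<close>, the element
  \<open>z - (1 / real n) *\<^sub>R u\<close> is a lower bound of \<open>D\<close>, hence at most 0;
  the Archimedean axiom then removes the multiples of \<open>u\<close>. The summand
  \<open>e *\<^sub>R u\<close> leaves room for an error of size \<open>e\<close> in a real
  coefficient.\<close>

lemma directed_to_zero_add_multiples:
  fixes D :: "'a::archimedean_vector_lattice set"
  assumes "directed_to_zero D" "0 \<le> u"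
  shows "directed_to_zero {d + e *\<^sub>R u | d e. d \<in> D \<and> e > 0}"
  unfolding directed_to_zero_def
proof (intro conjI ballI allI impI)
  let ?E = "{d + e *\<^sub>R u | d e. d \<in> D \<and> e > 0}"
  show "?E \<noteq> {}" using assms zero_less_one unfolding directed_to_zero_def by blast
  fix a b assume "a \<in> ?E" "b \<in> ?E"
  then obtain d e d' e' where *: "d \<in> D" "d' \<in> D" "e > 0" "e' > 0"
    "a = d + e *\<^sub>R u" "b = d' + e' *\<^sub>R u" by blast
  with assms obtain c where c: "c \<in> D" "c \<le> d" "c \<le> d'" unfolding directed_to_zero_def by blast
  have "c + min e e' *\<^sub>R u \<le> a" "c + min e e' *\<^sub>R u \<le> b"
    using * c assms(2) by (auto intro!: add_mono scaleR_right_mono)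
  moreover have "min e e' > 0" using * by simp
  ultimately show "\<exists>c\<in>?E. c \<le> a \<and> c \<le> b" using c(1) by blast
next
  fix z assume z: "\<forall>d\<in>{d + e *\<^sub>R u | d e. d \<in> D \<and> e > 0}. z \<le> d"
  show "z \<le> 0"
  proof (rule archimedean[OF assms(2)])
    fix n :: nat assume "n \<ge> 1"
    then have "1 / real n > 0" by simp
    then have "\<forall>d\<in>D. z \<le> d + (1 / real n) *\<^sub>R u" using z by blast
    then have "\<forall>d\<in>D. z - (1 / real n) *\<^sub>R u \<le> d" by (simp add: diff_le_eq)
    then have "z - (1 / real n) *\<^sub>R u \<le> 0"
      using assms(1) unfolding directed_to_zero_def by blast
    then show "z \<le> (1 / real n) *\<^sub>R u" by simp
  qed
qed

text \<open>Directedness puts some nonempty \<open>F k\<close> inside each finite intersection with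
  \<open>F i0\<close>, so the finite intersection property of the compact set \<open>F i0\<close>
  applies.\<close>

lemma compact_directed_inter_nonempty:
  fixes F :: "'i \<Rightarrow> 'b::t2_space set"
  assumes I: "I \<noteq> {}" and dir: "\<And>i j. i \<in> I \<Longrightarrow> j \<in> I \<Longrightarrow> \<exists>k\<in>I. F k \<subseteq> F i \<and> F k \<subseteq> F j"
    and ne: "\<And>i. i \<in> I \<Longrightarrow> F i \<noteq> {}" and cl: "\<And>i. i \<in> I \<Longrightarrow> closed (F i)"
    and i0: "i0 \<in> I" "compact (F i0)"
  shows "(\<Inter>i\<in>I. F i) \<noteq> {}"
proof -
  have lower: "\<exists>k\<in>I. F k \<subseteq> F i0 \<inter> \<Inter>(F ` J)" if "finite J" "J \<subseteq> I" for J
    using that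
  proof (induction J)
    case empty
    then show ?case using i0 by auto
  next
    case (insert j J)
    then obtain k where "k \<in> I" "F k \<subseteq> F i0 \<inter> \<Inter>(F ` J)" by auto
    moreover obtain k' where "k' \<in> I" "F k' \<subseteq> F k" "F k' \<subseteq> F j"
      using dir[of k j] calculation insert.prems by auto
    ultimately show ?case by (intro bexI[of _ k']) auto
  qed
  have "F i0 \<inter> \<Inter>(F ` I) \<noteq> {}"
  proof (rule compact_imp_fip_image[OF i0(2) cl])
    fix J assume "finite J" "J \<subseteq> I"
    with lower[of J] ne show "F i0 \<inter> \<Inter>(F ` J) \<noteq> {}" by fastforce
  qed
  then show ?thesis by blast
qed

lemma adherent_span_imp_mem:
  fixes l :: "'a::archimedean_vector_lattice"
  assumes "finite B" "directed_to_zero D" "\<And>d. d \<in> D \<Longrightarrow> \<exists>x\<in>span B. \<bar>x - l\<bar> \<le> d"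
  shows "l \<in> span B"
  using assms
\<comment> \<open>Both \<open>D\<close> and \<open>l\<close> must vary: the induction hypothesis is
  applied to \<open>b\<close> with multiples of one element, and to \<open>l - t *\<^sub>R b\<close>
  with an enlarged \<open>D\<close>.\<close>
proof (induction B arbitrary: D l rule: finite_induct)
  case empty
  then have "\<forall>d\<in>D. \<bar>l\<bar> \<le> d" by auto
  then have "\<bar>l\<bar> \<le> 0" using empty.prems(1) unfolding directed_to_zero_def by blast
  then show ?case by simp
next
  case (insert b B)
  show ?case
  \<comment> \<open>\<open>B\<close> is merely finite, so \<open>b\<close> may be redundant, and
    then the span does not grow. Otherwise \<open>b \<notin> span B\<close> is what contradicts
    unboundedness of \<open>T d\<close>.\<close>
  proof (cases "b \<in> span B")
    case True
    then show ?thesis using insert.IH[OF insert.prems(1)] insert.prems(2) by (simp add: span_redundant)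
  next
    case False
    define T where "T d = {t. \<exists>x\<in>span B. \<bar>x + t *\<^sub>R b - l\<bar> \<le> d}" for d
    have T_mono: "T c \<subseteq> T d" if "c \<le> d" for c d
      using that unfolding T_def by (blast intro: order_trans)
    have T_ne: "T d \<noteq> {}" if d: "d \<in> D" for d
    proof -
      obtain y where y: "y \<in> span (insert b B)" "\<bar>y - l\<bar> \<le> d" using insert.prems(2)[OF d] by blast
      then obtain t where "y - t *\<^sub>R b \<in> span B" by (auto simp: span_breakdown_eq)
      with y(2) have "t \<in> T d" unfolding T_def by (auto intro!: bexI[of _ "y - t *\<^sub>R b"])
      then show ?thesis by blast
    qed
    have T_bdd: "\<exists>r. T d \<subseteq> {-r..r}" for d
    proof (rule ccontr)
      assume "\<nexists>r. T d \<subseteq> {-r..r}"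
      then have "\<exists>t\<in>T d. \<bar>t\<bar> > real n" for n :: nat
        by (meson abs_le_iff atLeastAtMost_iff minus_le_iff not_le subsetI)
      then have unb: "\<exists>t x. x \<in> span B \<and> \<bar>x + t *\<^sub>R b - l\<bar> \<le> d \<and> \<bar>t\<bar> > real n" for n :: nat
        unfolding T_def by blast
      then have d0: "0 \<le> d" by (metis abs_ge_zero order_trans)
      have "b \<in> span B"
      proof (rule insert.IH)
        \<comment> \<open>From \<bar>x + t b\<bar> \<le> d + \<bar>l\<bar> and \<bar>t\<bar> > n,
          division by t puts - x / t within (d + \<bar>l\<bar>) / n of b; this dictates the
          dominating family.\<close>
        show "directed_to_zero {(1 / real n) *\<^sub>R (d + \<bar>l\<bar>) | n. n \<ge> 1}"
          by (rule directed_to_zero_multiples) (simp add: d0)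
        fix c assume "c \<in> {(1 / real n) *\<^sub>R (d + \<bar>l\<bar>) | n. n \<ge> 1}"
        then obtain n where n: "n \<ge> 1" "c = (1 / real n) *\<^sub>R (d + \<bar>l\<bar>)" by blast
        obtain t x where tx: "x \<in> span B" "\<bar>x + t *\<^sub>R b - l\<bar> \<le> d" "\<bar>t\<bar> > real n"
          using unb by blast
        have t0: "t \<noteq> 0" using tx(3) by auto
        have "\<bar>x + t *\<^sub>R b\<bar> \<le> \<bar>x + t *\<^sub>R b - l\<bar> + \<bar>l\<bar>"
          using abs_triangle_ineq[of "x + t *\<^sub>R b - l" l] by simp
        also have "\<dots> \<le> d + \<bar>l\<bar>" using tx(2) by simp
        finally have xt: "\<bar>x + t *\<^sub>R b\<bar> \<le> d + \<bar>l\<bar>" .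
        have "- ((1 / t) *\<^sub>R x) \<in> span B" using tx(1) by (intro span_neg span_scale)
        moreover have "\<bar>- ((1 / t) *\<^sub>R x) - b\<bar> \<le> c"
        proof -
          have "- ((1 / t) *\<^sub>R x) - b = (- 1 / t) *\<^sub>R (x + t *\<^sub>R b)"
            using t0 by (simp add: scaleR_add_right)
          then have "\<bar>- ((1 / t) *\<^sub>R x) - b\<bar> \<le> \<bar>- 1 / t\<bar> *\<^sub>R \<bar>x + t *\<^sub>R b\<bar>"
            by (metis abs_scaleR_le)
          also have "\<dots> \<le> \<bar>- 1 / t\<bar> *\<^sub>R (d + \<bar>l\<bar>)" using xt by (intro scaleR_left_mono) auto
          also have "\<dots> \<le> (1 / real n) *\<^sub>R (d + \<bar>l\<bar>)"
            using tx(3) n(1) d0 by (intro scaleR_right_mono) (auto simp: field_simps)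
          finally show ?thesis using n(2) by simp
        qed
        ultimately show "\<exists>x\<in>span B. \<bar>x - b\<bar> \<le> c" by blast
      qed
      with False show False by blast
    qed
    obtain d0 where d0: "d0 \<in> D" using insert.prems(1) unfolding directed_to_zero_def by blast
    \<comment> \<open>Taking closures supplies closed sets without a proof that \<open>T d\<close>
      itself is closed; the price is the extra multiple of \<bar>b\<bar> below. By
      \<open>T_bdd\<close> any \<open>d0\<close> in \<open>D\<close> gives a compact member.\<close>
    have "(\<Inter>d\<in>D. closure (T d)) \<noteq> {}"
    proof (rule compact_directed_inter_nonempty[OF _ _ _ _ d0])
      show "D \<noteq> {}" using d0 by blast
      show "\<exists>k\<in>D. closure (T k) \<subseteq> closure (T i) \<and> closure (T k) \<subseteq> closure (T j)"
        if "i \<in> D" "j \<in> D" for i j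
      proof -
        obtain k where "k \<in> D" "k \<le> i" "k \<le> j"
          using insert.prems(1) \<open>i \<in> D\<close> \<open>j \<in> D\<close> unfolding directed_to_zero_def by blast
        then show ?thesis by (meson T_mono closure_mono)
      qed
      show "closure (T i) \<noteq> {}" if "i \<in> D" for i using T_ne[OF that] by simp
      show "closed (closure (T i))" for i by simp
      obtain r where "T d0 \<subseteq> {-r..r}" using T_bdd by blast
      then have "closure (T d0) \<subseteq> {-r..r}" by (intro closure_minimal) auto
      then show "compact (closure (T d0))"
        using compact_Int_closed[OF compact_Icc closed_closure, of "-r" r "T d0"]
        by (simp add: Int_absorb1)
    qed
    then obtain t where t: "\<And>d. d \<in> D \<Longrightarrow> t \<in> closure (T d)" by blast
    have "l - t *\<^sub>R b \<in> span B"
    proof (rule insert.IH)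
      \<comment> \<open>Since \<open>t\<close> lies only in the closure of \<open>T d\<close>, it is
        replaced by some \<open>s\<close> in \<open>T d\<close> with \<bar>t - s\<bar> < e, which
        costs at most \<open>e *\<^sub>R \<bar>b\<bar>\<close>.\<close>
      show "directed_to_zero {d + e *\<^sub>R \<bar>b\<bar> | d e. d \<in> D \<and> e > 0}"
        using insert.prems(1) by (rule directed_to_zero_add_multiples) simp
      fix c assume "c \<in> {d + e *\<^sub>R \<bar>b\<bar> | d e. d \<in> D \<and> e > 0}"
      then obtain d e where de: "d \<in> D" "e > 0" "c = d + e *\<^sub>R \<bar>b\<bar>" by blast
      obtain s where s: "s \<in> T d" "\<bar>t - s\<bar> < e"
        using t[OF de(1)] de(2) by (metis closure_approachable dist_commute dist_real_def)
      then obtain x where x: "x \<in> span B" "\<bar>x + s *\<^sub>R b - l\<bar> \<le> d" unfolding T_def by blast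
      have "\<bar>x - (l - t *\<^sub>R b)\<bar> = \<bar>(x + s *\<^sub>R b - l) + (t - s) *\<^sub>R b\<bar>"
        by (simp add: algebra_simps)
      also have "\<dots> \<le> \<bar>x + s *\<^sub>R b - l\<bar> + \<bar>(t - s) *\<^sub>R b\<bar>" by (rule abs_triangle_ineq)
      also have "\<dots> \<le> d + e *\<^sub>R \<bar>b\<bar>"
      proof (rule add_mono[OF x(2)])
        have "\<bar>(t - s) *\<^sub>R b\<bar> \<le> \<bar>t - s\<bar> *\<^sub>R \<bar>b\<bar>" by (rule abs_scaleR_le)
        also have "\<dots> \<le> e *\<^sub>R \<bar>b\<bar>" using s(2) by (intro scaleR_right_mono) auto
        finally show "\<bar>(t - s) *\<^sub>R b\<bar> \<le> e *\<^sub>R \<bar>b\<bar>" .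
      qed
      finally show "\<exists>x\<in>span B. \<bar>x - (l - t *\<^sub>R b)\<bar> \<le> c" using x(1) de(3) by blast
    qed
    then show ?thesis by (auto simp: span_breakdown_eq)
  qed
qed

text \<open>Passage from nets to sets: \<open>D\<close> is the range of the dominating net, downward
  directed because that net decreases along a directed index set. Reflexivity of \<open>r\<close>
  lets each tail estimate be read off at its starting index.\<close>

lemma order_converges_imp_adherent:
  fixes l :: "'a::vector_lattice"
  assumes I: "directed_set I r" and conv: "order_converges TYPE('j) I r x l"
  obtains D where "directed_to_zero D" "\<And>d. d \<in> D \<Longrightarrow> \<exists>\<alpha>\<in>I. \<bar>x \<alpha> - l\<bar> \<le> d"
proof -
  obtain J :: "'j set" and s y where J: "directed_set J s" "decreases_to_zero J s y"
    and dom: "\<forall>\<beta>\<in>J. \<exists>\<alpha>0\<in>I. \<forall>\<alpha>\<in>I. (\<alpha>0, \<alpha>) \<in> r \<longrightarrow> \<bar>x \<alpha> - l\<bar> \<le> y \<beta>"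
    using conv unfolding order_converges_def by blast
  have "\<exists>c\<in>y ` J. c \<le> a \<and> c \<le> b" if ab: "a \<in> y ` J" "b \<in> y ` J" for a b
  proof -
    obtain i j where ij: "i \<in> J" "j \<in> J" "a = y i" "b = y j" using ab by blast
    then obtain k where "k \<in> J" "(i, k) \<in> s" "(j, k) \<in> s"
      using J(1) unfolding directed_set_def by blast
    then show ?thesis using J(2) ij unfolding decreases_to_zero_def by blast
  qed
  then have "directed_to_zero (y ` J)"
    using J unfolding directed_to_zero_def directed_set_def decreases_to_zero_def by simp
  moreover have "\<exists>\<alpha>\<in>I. \<bar>x \<alpha> - l\<bar> \<le> d" if d: "d \<in> y ` J" for d
  proof -
    obtain \<alpha> where "\<alpha> \<in> I" "\<forall>\<alpha>'\<in>I. (\<alpha>, \<alpha>') \<in> r \<longrightarrow> \<bar>x \<alpha>' - l\<bar> \<le> d"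
      using dom d by blast
    moreover from this have "(\<alpha>, \<alpha>) \<in> r"
      using I unfolding directed_set_def preorder_on_def refl_on_def by blast
    ultimately show ?thesis by blast
  qed
  ultimately show ?thesis by (rule that)
qed

lemma directed_set_singleton: "directed_set {i} {(i, i)}"
  by (auto simp: directed_set_def preorder_on_def refl_on_def trans_def)

lemma order_converges_const:
  fixes l :: "'a::vector_lattice"
  assumes "I \<noteq> {}"
  shows "order_converges TYPE('j) I r (\<lambda>_. l) l"
proof -
  \<comment> \<open>The dominating net is the constant 0 on one point; \<open>undefined\<close>
    merely names an element of the arbitrary index type.\<close>
  have "decreases_to_zero {undefined :: 'j} {(undefined, undefined)} (\<lambda>_. 0 :: 'a)"
    by (simp add: decreases_to_zero_def)
  then show ?thesis
    using assms directed_set_singleton[of "undefined :: 'j"] unfolding order_converges_def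
    by (intro exI[of _ "{undefined}"] exI[of _ "{(undefined, undefined)}"] exI[of _ "\<lambda>_. 0"]) auto
qed

theorem theorem3p2:
  fixes Y :: "'a::archimedean_vector_lattice set"
  assumes "finite_dimensional_subspace Y"
  shows "order_closed TYPE('i) TYPE('j) Y"
  unfolding order_closed_def
proof (intro equalityI subsetI CollectI)
  fix l assume "l \<in> Y"
  then show "\<exists>(I :: 'i set) r x. directed_set I r \<and> (\<forall>\<alpha>\<in>I. x \<alpha> \<in> Y) \<and>
      order_converges TYPE('j) I r x l"
    using directed_set_singleton[of "undefined :: 'i"] order_converges_const[of "{undefined :: 'i}"]
    by (intro exI[of _ "{undefined}"] exI[of _ "{(undefined, undefined)}"] exI[of _ "\<lambda>_. l"]) auto
next
  fix l assume "l \<in> {l. \<exists>(I :: 'i set) r x. directed_set I r \<and> (\<forall>\<alpha>\<in>I. x \<alpha> \<in> Y) \<and>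
      order_converges TYPE('j) I r x l}"
  then obtain I :: "'i set" and r x where I: "directed_set I r" "\<forall>\<alpha>\<in>I. x \<alpha> \<in> Y"
    and conv: "order_converges TYPE('j) I r x l" by blast
  obtain D where D: "directed_to_zero D" "\<And>d. d \<in> D \<Longrightarrow> \<exists>\<alpha>\<in>I. \<bar>x \<alpha> - l\<bar> \<le> d"
    using order_converges_imp_adherent[OF I(1) conv] by blast
  obtain B where B: "finite B" "span B = Y"
    using assms unfolding finite_dimensional_subspace_def by blast
  have "l \<in> span B"
    using D(2) I(2) B(2) by (intro adherent_span_imp_mem[OF B(1) D(1)]) blast
  then show "l \<in> Y" using B(2) by simp
qed

end
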